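(* Let $M$ be a monoid and let $\Delta_M=\{(m,m):m\in M\}\leq M\times M$. Let $(x_0,y_0),(x_1,y_1)\in M\times M$. Then the following hold: (i) if $(x_0,y_0)\,\mathscr{R}^{M\times M,\Delta_M}\,(x_1,y_1)$, then the right congruences on $M$ generated by $(x_0,y_0)$ and $(x_1,y_1)$ coincide; (ii) if $(x_0,y_0)\,\mathscr{L}^{M\times M,\Delta_M}\,(x_1,y_1)$, then the left congruences on $M$ generated by $(x_0,y_0)$ and $(x_1,y_1)$ coincide; (iii) if $(x_0,y_0)\,\mathscr{J}^{M\times M,\Delta_M}\,(x_1,y_1)$, then the 2-sided congruences on $M$ generated by $(x_0,y_0)$ and $(x_1,y_1)$ coincide.
   Context: The right (respectively left, 2-sided) congruence generated by a pair is the least right (respectively left, 2-sided) congruence containing it, where a right congruence is an equivalence relation $\rho$ with $(xs,ys)\in\rho$ for all $(x,y)\in\rho$, $s\in M$, left congruences are dual, and a 2-sided congruence is both. For a monoid $K$ and a submonoid $N\le K$ (with the same identity), the relative Green's relations on $K$ are defined for $x,y\in K$ by: $x\,\mathscr{L}^{K,N}\,y$ iff $Nx=Ny$, where $Nx=\{nx:n\in N\}$; $x\,\mathscr{R}^{K,N}\,y$ iff $xN=yN$; and $x\,\mathscr{J}^{K,N}\,y$ iff $NxN=NyN$, where $NxN=\{nxn':n,n'\in N\}$. Here $K=M\times M$ is the direct product and $N=\Delta_M$. *)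

theory Defs
  imports "HOL-Algebra.Coset"
begin

section \<open>Congruences on a monoid\<close>

definition right_congruence :: "('a, 'b) monoid_scheme \<Rightarrow> 'a rel \<Rightarrow> bool" where
  "right_congruence M \<rho> \<longleftrightarrow>
     equiv (carrier M) \<rho> \<and>
     (\<forall>(x, y) \<in> \<rho>. \<forall>s \<in> carrier M. (x \<otimes>\<^bsub>M\<^esub> s, y \<otimes>\<^bsub>M\<^esub> s) \<in> \<rho>)"

definition left_congruence :: "('a, 'b) monoid_scheme \<Rightarrow> 'a rel \<Rightarrow> bool" where
  "left_congruence M \<rho> \<longleftrightarrow>
     equiv (carrier M) \<rho> \<and>
     (\<forall>(x, y) \<in> \<rho>. \<forall>s \<in> carrier M. (s \<otimes>\<^bsub>M\<^esub> x, s \<otimes>\<^bsub>M\<^esub> y) \<in> \<rho>)"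

definition two_sided_congruence :: "('a, 'b) monoid_scheme \<Rightarrow> 'a rel \<Rightarrow> bool" where
  "two_sided_congruence M \<rho> \<longleftrightarrow> right_congruence M \<rho> \<and> left_congruence M \<rho>"

text \<open>
  The least congruence of each kind containing a pair is given as an intersection. The lemmas
  below show that, for a pair of elements of the monoid, this is again a congruence of that kind
  containing the pair, and hence the least one.
\<close>

definition right_congruence_gen :: "('a, 'b) monoid_scheme \<Rightarrow> 'a \<times> 'a \<Rightarrow> 'a rel" where
  "right_congruence_gen M p = \<Inter>{\<rho>. right_congruence M \<rho> \<and> p \<in> \<rho>}"

definition left_congruence_gen :: "('a, 'b) monoid_scheme \<Rightarrow> 'a \<times> 'a \<Rightarrow> 'a rel" where
  "left_congruence_gen M p = \<Inter>{\<rho>. left_congruence M \<rho> \<and> p \<in> \<rho>}"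

definition two_sided_congruence_gen :: "('a, 'b) monoid_scheme \<Rightarrow> 'a \<times> 'a \<Rightarrow> 'a rel" where
  "two_sided_congruence_gen M p = \<Inter>{\<rho>. two_sided_congruence M \<rho> \<and> p \<in> \<rho>}"

lemma equiv_Times: "equiv A (A \<times> A)"
  by (auto simp: equiv_def refl_on_def sym_def trans_def)

lemma equiv_Inter:
  assumes "\<C> \<noteq> {}" and "\<And>\<rho>. \<rho> \<in> \<C> \<Longrightarrow> equiv A \<rho>"
  shows "equiv A (\<Inter>\<C>)"
proof (rule equivI)
  show "\<Inter>\<C> \<subseteq> A \<times> A"
    using assms unfolding equiv_def by blast
  show "refl_on A (\<Inter>\<C>)"
    using assms unfolding equiv_def refl_on_def by blast
  show "sym (\<Inter>\<C>)"
    using assms unfolding equiv_def sym_def by blast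
  show "trans (\<Inter>\<C>)"
    using assms(2) unfolding equiv_def trans_def by (meson InterE InterI)
qed

lemma right_congruence_Times:
  "monoid M \<Longrightarrow> right_congruence M (carrier M \<times> carrier M)"
  by (auto simp: right_congruence_def equiv_Times monoid.m_closed)

lemma left_congruence_Times:
  "monoid M \<Longrightarrow> left_congruence M (carrier M \<times> carrier M)"
  by (auto simp: left_congruence_def equiv_Times monoid.m_closed)

lemma right_congruence_Inter:
  assumes "\<C> \<noteq> {}" and "\<And>\<rho>. \<rho> \<in> \<C> \<Longrightarrow> right_congruence M \<rho>"
  shows "right_congruence M (\<Inter>\<C>)"
  using assms equiv_Inter[of \<C> "carrier M"] unfolding right_congruence_def by fast

lemma left_congruence_Inter:
  assumes "\<C> \<noteq> {}" and "\<And>\<rho>. \<rho> \<in> \<C> \<Longrightarrow> left_congruence M \<rho>"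
  shows "left_congruence M (\<Inter>\<C>)"
  using assms equiv_Inter[of \<C> "carrier M"] unfolding left_congruence_def by fast

lemma right_congruence_gen_least:
  assumes "monoid M" and "p \<in> carrier M \<times> carrier M"
  shows "right_congruence M (right_congruence_gen M p)"
    and "p \<in> right_congruence_gen M p"
    and "\<And>\<rho>. right_congruence M \<rho> \<Longrightarrow> p \<in> \<rho> \<Longrightarrow> right_congruence_gen M p \<subseteq> \<rho>"
  unfolding right_congruence_gen_def
  using assms right_congruence_Times[of M]
  by (auto intro!: right_congruence_Inter)

lemma left_congruence_gen_least:
  assumes "monoid M" and "p \<in> carrier M \<times> carrier M"
  shows "left_congruence M (left_congruence_gen M p)"
    and "p \<in> left_congruence_gen M p"
    and "\<And>\<rho>. left_congruence M \<rho> \<Longrightarrow> p \<in> \<rho> \<Longrightarrow> left_congruence_gen M p \<subseteq> \<rho>"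
  unfolding left_congruence_gen_def
  using assms left_congruence_Times[of M]
  by (auto intro!: left_congruence_Inter)

lemma two_sided_congruence_gen_least:
  assumes "monoid M" and "p \<in> carrier M \<times> carrier M"
  shows "two_sided_congruence M (two_sided_congruence_gen M p)"
    and "p \<in> two_sided_congruence_gen M p"
    and "\<And>\<rho>. two_sided_congruence M \<rho> \<Longrightarrow> p \<in> \<rho> \<Longrightarrow> two_sided_congruence_gen M p \<subseteq> \<rho>"
  unfolding two_sided_congruence_gen_def two_sided_congruence_def
  using assms right_congruence_Times[of M] left_congruence_Times[of M]
  by (auto intro!: right_congruence_Inter left_congruence_Inter)

section \<open>Relative Green's relations\<close>

text \<open>
  For a monoid \<open>K\<close> with a submonoid \<open>N\<close>. The set operations are the ones the library introduces
  for cosets: \<open>N #> x\<close> is $Nx$, \<open>x <# N\<close> is $xN$ and \<open>N #> x <#> N\<close> is $NxN$.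
\<close>

definition rel_L :: "('a, 'b) monoid_scheme \<Rightarrow> 'a set \<Rightarrow> 'a rel" where
  "rel_L K N = {(x, y). x \<in> carrier K \<and> y \<in> carrier K \<and> N #>\<^bsub>K\<^esub> x = N #>\<^bsub>K\<^esub> y}"

definition rel_R :: "('a, 'b) monoid_scheme \<Rightarrow> 'a set \<Rightarrow> 'a rel" where
  "rel_R K N = {(x, y). x \<in> carrier K \<and> y \<in> carrier K \<and> x <#\<^bsub>K\<^esub> N = y <#\<^bsub>K\<^esub> N}"

definition rel_J :: "('a, 'b) monoid_scheme \<Rightarrow> 'a set \<Rightarrow> 'a rel" where
  "rel_J K N = {(x, y). x \<in> carrier K \<and> y \<in> carrier K \<and>
     (N #>\<^bsub>K\<^esub> x) <#>\<^bsub>K\<^esub> N = (N #>\<^bsub>K\<^esub> y) <#>\<^bsub>K\<^esub> N}"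

section \<open>The diagonal submonoid\<close>

definition diag :: "('a, 'b) monoid_scheme \<Rightarrow> ('a \<times> 'a) set" where
  "diag M = {(m, m) | m. m \<in> carrier M}"

lemma submonoid_diag: "monoid M \<Longrightarrow> submonoid (diag M) (M \<times>\<times> M)"
  by (auto simp: submonoid_def diag_def monoid.m_closed monoid.one_closed)

end

theory Submission
  imports Defs
begin

text \<open>
  Acting on a pair by the diagonal means multiplying both of its entries by the same element of
  the monoid, and a congruence of the given kind is closed under exactly this operation. Since the
  diagonal contains the identity, such a congruence therefore contains a pair if and only if it
  contains the whole orbit of that pair under the diagonal (\<open>right_congruence_mem_iff\<close> and its left
  and 2-sided versions). A relative Green's relation says that two pairs have the same orbit, so
  the congruences that contain one pair are those that contain the other, and the two families
  have the same intersection.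
\<close>

lemma l_coset_diag:
  "(x, y) <#\<^bsub>M \<times>\<times> M\<^esub> diag M = {(x \<otimes>\<^bsub>M\<^esub> s, y \<otimes>\<^bsub>M\<^esub> s) | s. s \<in> carrier M}"
  by (auto simp: l_coset_def diag_def)

lemma r_coset_diag:
  "diag M #>\<^bsub>M \<times>\<times> M\<^esub> (x, y) = {(s \<otimes>\<^bsub>M\<^esub> x, s \<otimes>\<^bsub>M\<^esub> y) | s. s \<in> carrier M}"
  by (auto simp: r_coset_def diag_def)

lemma set_mult_diag:
  "A <#>\<^bsub>M \<times>\<times> M\<^esub> diag M = (\<Union>p\<in>A. p <#\<^bsub>M \<times>\<times> M\<^esub> diag M)"
  by (auto simp: set_mult_def l_coset_def)

text \<open>
  From left to right this is compatibility with right multiplication. The converse holds because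
  multiplying by the identity puts a pair of elements of \<open>M\<close> into its own orbit.
\<close>

lemma right_congruence_mem_iff:
  assumes "monoid M" and "right_congruence M \<rho>" and "p \<in> carrier (M \<times>\<times> M)"
  shows "p \<in> \<rho> \<longleftrightarrow> p <#\<^bsub>M \<times>\<times> M\<^esub> diag M \<subseteq> \<rho>"
proof -
  interpret monoid M by fact
  obtain x y where p: "p = (x, y)" and xy: "x \<in> carrier M" "y \<in> carrier M"
    using assms(3) by auto
  have "(x, y) \<in> (x, y) <#\<^bsub>M \<times>\<times> M\<^esub> diag M"
    unfolding l_coset_diag using xy by (intro CollectI exI[of _ "\<one>\<^bsub>M\<^esub>"]) simp
  then show ?thesis
    using assms(2) by (auto simp: p l_coset_diag right_congruence_def)
qed

lemma left_congruence_mem_iff: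
  assumes "monoid M" and "left_congruence M \<rho>" and "p \<in> carrier (M \<times>\<times> M)"
  shows "p \<in> \<rho> \<longleftrightarrow> diag M #>\<^bsub>M \<times>\<times> M\<^esub> p \<subseteq> \<rho>"
proof -
  interpret monoid M by fact
  obtain x y where p: "p = (x, y)" and xy: "x \<in> carrier M" "y \<in> carrier M"
    using assms(3) by auto
  have "(x, y) \<in> diag M #>\<^bsub>M \<times>\<times> M\<^esub> (x, y)"
    unfolding r_coset_diag using xy by (intro CollectI exI[of _ "\<one>\<^bsub>M\<^esub>"]) simp
  then show ?thesis
    using assms(2) by (auto simp: p r_coset_diag left_congruence_def)
qed

text \<open>
  The 2-sided orbit is the union of the right orbits of the pairs in the left orbit, so this is
  the left criterion followed by the right criterion at each of those pairs.
\<close>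

lemma two_sided_congruence_mem_iff:
  assumes "monoid M" and "two_sided_congruence M \<rho>" and "p \<in> carrier (M \<times>\<times> M)"
  shows "p \<in> \<rho> \<longleftrightarrow> (diag M #>\<^bsub>M \<times>\<times> M\<^esub> p) <#>\<^bsub>M \<times>\<times> M\<^esub> diag M \<subseteq> \<rho>"
proof -
  interpret monoid M by fact
  have r: "right_congruence M \<rho>" and l: "left_congruence M \<rho>"
    using assms(2) by (auto simp: two_sided_congruence_def)
  have orbit_closed: "diag M #>\<^bsub>M \<times>\<times> M\<^esub> p \<subseteq> carrier (M \<times>\<times> M)"
    using assms(3) by (cases p) (auto simp: r_coset_diag)
  have "p \<in> \<rho> \<longleftrightarrow> (\<forall>q \<in> diag M #>\<^bsub>M \<times>\<times> M\<^esub> p. q \<in> \<rho>)"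
    using left_congruence_mem_iff[OF assms(1) l assms(3)] by blast
  also have "\<dots> \<longleftrightarrow> (\<forall>q \<in> diag M #>\<^bsub>M \<times>\<times> M\<^esub> p. q <#\<^bsub>M \<times>\<times> M\<^esub> diag M \<subseteq> \<rho>)"
    using right_congruence_mem_iff[OF assms(1) r] orbit_closed by blast
  also have "\<dots> \<longleftrightarrow> (diag M #>\<^bsub>M \<times>\<times> M\<^esub> p) <#>\<^bsub>M \<times>\<times> M\<^esub> diag M \<subseteq> \<rho>"
    by (simp only: set_mult_diag UN_subset_iff)
  finally show ?thesis .
qed

lemma right_congruence_gen_eq:
  assumes "monoid M" and "(p, q) \<in> rel_R (M \<times>\<times> M) (diag M)"
  shows "right_congruence_gen M p = right_congruence_gen M q"
proof -
  have "p \<in> \<rho> \<longleftrightarrow> q \<in> \<rho>" if "right_congruence M \<rho>" for \<rho>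
    using assms(2) right_congruence_mem_iff[OF assms(1) that] by (simp add: rel_R_def)
  then show ?thesis
    unfolding right_congruence_gen_def by (metis (no_types, lifting))
qed

lemma left_congruence_gen_eq:
  assumes "monoid M" and "(p, q) \<in> rel_L (M \<times>\<times> M) (diag M)"
  shows "left_congruence_gen M p = left_congruence_gen M q"
proof -
  have "p \<in> \<rho> \<longleftrightarrow> q \<in> \<rho>" if "left_congruence M \<rho>" for \<rho>
    using assms(2) left_congruence_mem_iff[OF assms(1) that] by (simp add: rel_L_def)
  then show ?thesis
    unfolding left_congruence_gen_def by (metis (no_types, lifting))
qed

lemma two_sided_congruence_gen_eq:
  assumes "monoid M" and "(p, q) \<in> rel_J (M \<times>\<times> M) (diag M)"
  shows "two_sided_congruence_gen M p = two_sided_congruence_gen M q"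
proof -
  have "p \<in> \<rho> \<longleftrightarrow> q \<in> \<rho>" if "two_sided_congruence M \<rho>" for \<rho>
    using assms(2) two_sided_congruence_mem_iff[OF assms(1) that] by (simp add: rel_J_def)
  then show ?thesis
    unfolding two_sided_congruence_gen_def by (metis (no_types, lifting))
qed

theorem proposition7p1:
  fixes M :: "('a, 'b) monoid_scheme" and x0 y0 x1 y1 :: 'a
  assumes "monoid M"
    and "(x0, y0) \<in> carrier (M \<times>\<times> M)"
    and "(x1, y1) \<in> carrier (M \<times>\<times> M)"
  shows "(((x0, y0), (x1, y1)) \<in> rel_R (M \<times>\<times> M) (diag M) \<longrightarrow>
            right_congruence_gen M (x0, y0) = right_congruence_gen M (x1, y1))
       \<and> (((x0, y0), (x1, y1)) \<in> rel_L (M \<times>\<times> M) (diag M) \<longrightarrow>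
            left_congruence_gen M (x0, y0) = left_congruence_gen M (x1, y1))
       \<and> (((x0, y0), (x1, y1)) \<in> rel_J (M \<times>\<times> M) (diag M) \<longrightarrow>
            two_sided_congruence_gen M (x0, y0) = two_sided_congruence_gen M (x1, y1))"
  using right_congruence_gen_eq[OF assms(1)] left_congruence_gen_eq[OF assms(1)]
    two_sided_congruence_gen_eq[OF assms(1)]
  by blast

end
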